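(* Let $G$ be a finite simple graph of order $n$ and let $H$ be a finite simple graph. (i) If $G$ has at least one connected component of order greater than two, then $\gamma_R(G\Box H)\le (n+1)\gamma_R(H)-2\gamma(H)$. (ii) If $G$ is a Roman graph, then $\gamma_R(G\Box H)\le 2n\left(\gamma_R(H)-\gamma(H)\right)+2\gamma(G)\left(2\gamma(H)-\gamma_R(H)\right)$.
   Context: $\gamma(X)$ denotes the domination number of a graph $X$ (minimum size of a set $D$ such that every vertex outside $D$ has a neighbor in $D$). A Roman dominating function on $X$ is a map $f:V(X)\to\{0,1,2\}$ such that every vertex $v$ with $f(v)=0$ has a neighbor $u$ with $f(u)=2$; $\gamma_R(X)$ is the minimum of $\sum_v f(v)$ over such $f$. A graph $G$ is Roman if $\gamma_R(G)=2\gamma(G)$. The Cartesian product $G\Box H$ has vertex set $V(G)\times V(H)$, with $(g,h)\sim(g',h')$ iff ($g=g'$ and $h\sim h'$) or ($g\sim g'$ and $h=h'$). *)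

theory Defs
  imports "Graph_Theory.Pair_Digraph" "Graph_Theory.Digraph_Component"
begin

text \<open>
  A finite simple graph is a \<^locale>\<open>pair_graph\<close>: a finite vertex set with a symmetric,
  irreflexive set of arcs, each undirected edge being represented by its two arcs.
\<close>

definition dominating_set :: "'a pair_pre_digraph \<Rightarrow> 'a set \<Rightarrow> bool" where
  "dominating_set G D \<longleftrightarrow>
     D \<subseteq> pverts G \<and> (\<forall>v \<in> pverts G - D. \<exists>u \<in> D. (v, u) \<in> parcs G)"

definition domination_number :: "'a pair_pre_digraph \<Rightarrow> nat" where
  "domination_number G = (LEAST k. \<exists>D. dominating_set G D \<and> card D = k)"

text \<open>Values of \<open>f\<close> outside the vertex set are unconstrained and never counted.\<close>

definition roman_dominating_function :: "'a pair_pre_digraph \<Rightarrow> ('a \<Rightarrow> nat) \<Rightarrow> bool" where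
  "roman_dominating_function G f \<longleftrightarrow>
     (\<forall>v \<in> pverts G. f v \<in> {0, 1, 2}) \<and>
     (\<forall>v \<in> pverts G. f v = 0 \<longrightarrow> (\<exists>u \<in> pverts G. (v, u) \<in> parcs G \<and> f u = 2))"

definition roman_domination_number :: "'a pair_pre_digraph \<Rightarrow> nat" where
  "roman_domination_number G =
     (LEAST k. \<exists>f. roman_dominating_function G f \<and> (\<Sum>v \<in> pverts G. f v) = k)"

definition roman_graph :: "'a pair_pre_digraph \<Rightarrow> bool" where
  "roman_graph G \<longleftrightarrow> roman_domination_number G = 2 * domination_number G"

definition cartesian_product ::
  "'a pair_pre_digraph \<Rightarrow> 'b pair_pre_digraph \<Rightarrow> ('a \<times> 'b) pair_pre_digraph" (infixr \<open>\<box>\<close> 70)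
where
  "G \<box> H =
     \<lparr> pverts = pverts G \<times> pverts H,
       parcs = {((g, h), (g', h')).
         g \<in> pverts G \<and> g' \<in> pverts G \<and> h \<in> pverts H \<and> h' \<in> pverts H \<and>
         (g = g' \<and> (h, h') \<in> parcs H \<or> (g, g') \<in> parcs G \<and> h = h')} \<rparr>"

text \<open>
  A connected component is a maximal connected subgraph; maximality among all subgraphs forces it
  to be induced, in particular symmetric.
\<close>

definition connected_component :: "'a pair_pre_digraph \<Rightarrow> 'a pair_pre_digraph \<Rightarrow> bool" where
  "connected_component G C \<longleftrightarrow>
     pre_digraph.max_subgraph (with_proj G) Digraph_Component.connected (with_proj C)"

lemma pair_graph_cartesian_product:
  assumes "pair_graph G" "pair_graph H"
  shows "pair_graph (G \<box> H)"
proof -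
  interpret G: pair_graph G by fact
  interpret H: pair_graph H by fact
  have "finite (parcs (G \<box> H))"
    by (rule finite_subset[of _ "(pverts G \<times> pverts H) \<times> (pverts G \<times> pverts H)"])
      (auto simp: cartesian_product_def)
  moreover have "symmetric (G \<box> H)"
    using G.sym_arcs H.sym_arcs
    by (auto simp: symmetric_def sym_def cartesian_product_def)
  ultimately show ?thesis
    by unfold_locales
      (auto simp: cartesian_product_def dest: G.pair_no_loops H.pair_no_loops)
qed

end

theory Submission
  imports Defs
begin

text \<open>
  Let \<open>f\<close> be a minimum Roman dominating function of \<open>H\<close>. Raising the value 1 to 2 costs as much as
  lowering it to 0 saves, and the raised function has weight at least \<open>2 \<gamma>(H)\<close>. In a product fibre
  \<open>{a} \<times> H\<close> the lowered function is admissible as soon as some neighbouring fibre carries the raised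
  one. So raise on the fibres over a set \<open>D\<close>, lower on the fibres over a set \<open>A\<close> each of whose
  vertices has a neighbour in \<open>D\<close>, and use \<open>f\<close> elsewhere: if \<open>|D| \<le> |A|\<close>, this gives
  \<open>\<gamma>\<^sub>R(G \<box> H) \<le> n \<gamma>\<^sub>R(H) - (|A| - |D|) (2 \<gamma>(H) - \<gamma>\<^sub>R(H))\<close>.
  For (i) take \<open>D\<close> the centre and \<open>A\<close> the ends of a path on three vertices. For (ii) take a minimum
  dominating set and its complement; \<open>2 \<gamma>(G) = \<gamma>\<^sub>R(G) \<le> n\<close> because the constant function 1 is
  Roman dominating.
\<close>

lemma domination_number_le:
  "dominating_set G D \<Longrightarrow> domination_number G \<le> card D"
  unfolding domination_number_def by (rule Least_le) auto

lemma domination_number_attained: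
  obtains D where "dominating_set G D" "card D = domination_number G"
proof -
  have "dominating_set G (pverts G)"
    by (simp add: dominating_set_def)
  then have "\<exists>k D. dominating_set G D \<and> card D = k" by blast
  from LeastI_ex[OF this] show ?thesis
    unfolding domination_number_def[symmetric] by (elim exE conjE) (rule that)
qed

lemma roman_domination_number_le:
  "roman_dominating_function G f \<Longrightarrow> roman_domination_number G \<le> sum f (pverts G)"
  unfolding roman_domination_number_def by (rule Least_le) auto

lemma roman_dominating_function_one: "roman_dominating_function G (\<lambda>_. 1)"
  by (simp add: roman_dominating_function_def)

lemma roman_domination_number_attained:
  obtains f where "roman_dominating_function G f" "sum f (pverts G) = roman_domination_number G"
proof -
  have "\<exists>k f. roman_dominating_function G f \<and> sum f (pverts G) = k"
    using roman_dominating_function_one by blast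
  from LeastI_ex[OF this] show ?thesis
    unfolding roman_domination_number_def[symmetric] by (elim exE conjE) (rule that)
qed

lemma roman_domination_number_le_card: "roman_domination_number G \<le> card (pverts G)"
  using roman_domination_number_le[OF roman_dominating_function_one, of G] by simp

text \<open>A vertex of value 0 has a neighbour of value 2, and that neighbour lies in the
  support.\<close>

lemma dominating_set_roman_support:
  assumes "roman_dominating_function G f"
  shows "dominating_set G {v \<in> pverts G. f v \<noteq> 0}"
  using assms unfolding dominating_set_def roman_dominating_function_def by fastforce

definition raise :: "('a \<Rightarrow> nat) \<Rightarrow> 'a \<Rightarrow> nat" where
  "raise f v = (if f v = 0 then 0 else 2)"

definition lower :: "('a \<Rightarrow> nat) \<Rightarrow> 'a \<Rightarrow> nat" where
  "lower f v = (if f v = 2 then 2 else 0)"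

text \<open>The identity is pointwise: the values 0, 1, 2 give 0 + 0, 2 + 0, 2 + 2.\<close>

lemma sum_raise_lower:
  assumes "roman_dominating_function G f"
  shows "sum (raise f) (pverts G) + sum (lower f) (pverts G) = 2 * sum f (pverts G)"
  unfolding sum.distrib[symmetric] sum_distrib_left
  using assms
  by (intro sum.cong) (auto simp: raise_def lower_def roman_dominating_function_def)

text \<open>\<open>raise f\<close> is twice the indicator of the support of \<open>f\<close>, which
  is a dominating set.\<close>

lemma sum_raise_ge:
  assumes "finite (pverts G)" "roman_dominating_function G f"
  shows "2 * domination_number G \<le> sum (raise f) (pverts G)"
proof -
  have "sum (raise f) (pverts G) = (\<Sum>v\<in>{v \<in> pverts G. f v \<noteq> 0}. 2)"
    using assms(1) by (intro sum.mono_neutral_cong_right) (auto simp: raise_def)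
  with domination_number_le[OF dominating_set_roman_support[OF assms(2)]] show ?thesis
    by simp
qed

lemma roman_dominating_function_product:
  assumes f: "roman_dominating_function H f"
    and D: "D \<subseteq> pverts G"
    and dom: "\<And>a. a \<in> A \<Longrightarrow> \<exists>d\<in>D. (a, d) \<in> parcs G"
  shows "roman_dominating_function (G \<box> H)
    (\<lambda>(g, h). if g \<in> D then raise f h else if g \<in> A then lower f h else f h)"
    (is "roman_dominating_function _ ?F")
  unfolding roman_dominating_function_def
proof (intro conjI ballI impI)
  fix v assume "v \<in> pverts (G \<box> H)"
  then obtain g h where gh: "v = (g, h)" "h \<in> pverts H"
    by (auto simp: cartesian_product_def)
  then have "f h \<in> {0, 1, 2}"
    using f by (simp add: roman_dominating_function_def)
  then show "?F v \<in> {0, 1, 2}"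
    by (simp add: gh(1) raise_def lower_def)
next
  fix v assume v: "v \<in> pverts (G \<box> H)" and 0: "?F v = 0"
  obtain g h where gh: "v = (g, h)" "g \<in> pverts G" "h \<in> pverts H"
    using v by (auto simp: cartesian_product_def)
  show "\<exists>u \<in> pverts (G \<box> H). (v, u) \<in> parcs (G \<box> H) \<and> ?F u = 2"
  proof (cases "f h = 0")
    case True
    then obtain k where "k \<in> pverts H" "(h, k) \<in> parcs H" "f k = 2"
      using f gh by (auto simp: roman_dominating_function_def)
    \<comment> \<open>Both \<open>raise\<close> and \<open>lower\<close> fix the value 2, so the
      neighbour \<open>k\<close> serves in whichever fibre \<open>g\<close> lies.\<close>
    then have "(g, k) \<in> pverts (G \<box> H)" "(v, (g, k)) \<in> parcs (G \<box> H)" "?F (g, k) = 2"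
      using gh by (simp_all add: cartesian_product_def raise_def lower_def)
    then show ?thesis by blast
  next
    case False
    \<comment> \<open>A nonzero value of \<open>f\<close> stays nonzero under \<open>raise\<close>
      and when left alone; only \<open>lower\<close> can turn it into 0.\<close>
    then have "g \<in> A"
      using 0 by (simp add: gh(1) raise_def split: if_split_asm)
    with dom obtain d where d: "d \<in> D" "(g, d) \<in> parcs G" by blast
    then have "d \<in> pverts G" using D by blast
    \<comment> \<open>The fibre over \<open>d\<close> carries \<open>raise f\<close>, whose value at
      \<open>h\<close> is 2 because \<open>f h\<close> is nonzero.\<close>
    with d False have "(d, h) \<in> pverts (G \<box> H)" "(v, (d, h)) \<in> parcs (G \<box> H)"
      "?F (d, h) = 2"
      using gh by (simp_all add: cartesian_product_def raise_def)
    then show ?thesis by blast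
  qed
qed

lemma sum_if_if:
  fixes x y z :: nat
  assumes "finite V" "D \<subseteq> V" "A \<subseteq> V" "A \<inter> D = {}"
  shows "(\<Sum>g\<in>V. if g \<in> D then x else if g \<in> A then y else z) =
    card D * x + card A * y + (card V - card D - card A) * z"
proof -
  define R where "R = V - (D \<union> A)"
  have fin: "finite D" "finite A" "finite R"
    using assms by (auto simp: R_def intro: finite_subset)
  have "card R = card V - card (D \<union> A)"
    unfolding R_def using assms fin by (intro card_Diff_subset) auto
  also have "card (D \<union> A) = card D + card A"
    using assms fin by (intro card_Un_disjoint) auto
  finally have R: "card R = card V - card D - card A" by simp
  let ?F = "\<lambda>g. if g \<in> D then x else if g \<in> A then y else z"
  have "V = D \<union> (A \<union> R)" using assms by (auto simp: R_def)
  then have "sum ?F V = sum ?F (D \<union> (A \<union> R))" by (rule arg_cong)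
  also have "\<dots> = sum ?F D + sum ?F (A \<union> R)"
    by (rule sum.union_disjoint) (use fin assms in \<open>auto simp: R_def\<close>)
  also have "sum ?F (A \<union> R) = sum ?F A + sum ?F R"
    by (rule sum.union_disjoint) (use fin assms in \<open>auto simp: R_def\<close>)
  also have "sum ?F D = (\<Sum>g\<in>D. x)" by (rule sum.cong) auto
  also have "sum ?F A = (\<Sum>g\<in>A. y)" by (rule sum.cong) (use assms in auto)
  also have "sum ?F R = (\<Sum>g\<in>R. z)" by (rule sum.cong) (auto simp: R_def)
  finally show ?thesis by (simp add: R)
qed

lemma roman_domination_number_product_le:
  assumes fin: "finite (pverts G)" "finite (pverts H)"
    and sub: "D \<subseteq> pverts G" "A \<subseteq> pverts G" "A \<inter> D = {}"
    and dom: "\<And>a. a \<in> A \<Longrightarrow> \<exists>d\<in>D. (a, d) \<in> parcs G"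
    and le: "card D \<le> card A"
  shows "int (roman_domination_number (G \<box> H)) \<le>
    int (card (pverts G)) * int (roman_domination_number H) -
    (int (card A) - int (card D)) *
      (2 * int (domination_number H) - int (roman_domination_number H))"
proof -
  obtain f where f: "roman_dominating_function H f"
    and W: "sum f (pverts H) = roman_domination_number H"
    by (rule roman_domination_number_attained)
  define F where "F = (\<lambda>(g, h). if g \<in> D then raise f h else if g \<in> A then lower f h else f h)"
  define K L where "K = sum (raise f) (pverts H)" and "L = sum (lower f) (pverts H)"
  let ?W = "roman_domination_number H" and ?n = "card (pverts G)"
  \<comment> \<open>This makes the truncated subtraction counting the unchanged fibres exact, so
    that it can be moved to the integers.\<close>
  have "card D + card A \<le> ?n"
    using fin sub card_mono[of "pverts G" "D \<union> A"] card_Un_disjoint[of D A]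
    by (metis Int_commute Un_subset_iff finite_subset)
  then have n: "int (?n - card D - card A) = int ?n - int (card D) - int (card A)"
    by linarith
  have K: "2 * int (domination_number H) \<le> int K"
    using sum_raise_ge[OF fin(2) f] unfolding K_def by linarith
  have KL: "int L = 2 * int ?W - int K"
    using sum_raise_lower[OF f] unfolding K_def L_def W by linarith
  have "roman_domination_number (G \<box> H) \<le> sum F (pverts (G \<box> H))"
    unfolding F_def
    by (intro roman_domination_number_le roman_dominating_function_product f sub dom)
  also have "\<dots> = (\<Sum>g\<in>pverts G. \<Sum>h\<in>pverts H. F (g, h))"
    by (simp add: cartesian_product_def sum.cartesian_product)
  also have "\<dots> = (\<Sum>g\<in>pverts G. if g \<in> D then K else if g \<in> A then L else ?W)"
    by (intro sum.cong) (auto simp: F_def K_def L_def W)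
  also have "\<dots> = card D * K + card A * L + (?n - card D - card A) * ?W"
    by (rule sum_if_if[OF fin(1) sub])
  finally have "int (roman_domination_number (G \<box> H)) \<le>
      int (card D * K + card A * L + (?n - card D - card A) * ?W)"
    by (simp only: of_nat_le_iff)
  \<comment> \<open>Substituting \<open>L = 2 * ?W - K\<close>: each fibre over \<open>D\<close>
    costs \<open>K - ?W\<close> extra, and each fibre over \<open>A\<close> saves the same
    amount.\<close>
  also have "\<dots> = int ?n * int ?W - (int (card A) - int (card D)) * (int K - int ?W)"
    by (simp only: of_nat_add of_nat_mult n KL) (simp add: algebra_simps)
  \<comment> \<open>Replacing \<open>K\<close> by its lower bound weakens the estimate because the
    factor \<open>card A - card D\<close> is nonnegative.\<close>
  also have "\<dots> \<le> int ?n * int ?W -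
      (int (card A) - int (card D)) * (2 * int (domination_number H) - int ?W)"
    using K le by (intro diff_left_mono mult_left_mono) auto
  finally show ?thesis .
qed

text \<open>If every vertex had at most one neighbour, a walk from \<open>u\<close> could only
  alternate between \<open>u\<close> and that neighbour, so a component would have at most two
  vertices.\<close>

lemma connected_component_two_neighbours:
  assumes "pair_graph G" "connected_component G C" "card (pverts C) > 2"
  obtains a b c where "(a, c) \<in> parcs G" "(b, c) \<in> parcs G" "a \<noteq> b"
proof -
  interpret pair_graph G by fact
  have sub: "subgraph (with_proj C) (with_proj G)"
    and conn: "Digraph_Component.connected (with_proj C)"
    using assms(2) by (auto simp: connected_component_def pre_digraph.max_subgraph_def)
  have sym: "(y, x) \<in> parcs G" if "(x, y) \<in> parcs G" for x y
    using that sym_arcs by (auto simp: symmetric_def sym_def)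
  \<comment> \<open>Connectedness of \<open>C\<close> speaks of walks in its symmetric closure; as
    \<open>G\<close> is symmetric, their arcs are still arcs of \<open>G\<close>.\<close>
  have arcs: "(y, x) \<in> parcs G" "(x, y) \<in> parcs G" if "(x, y) \<in> parcs (mk_symmetric C)" for x y
    using that sub by (auto simp: parcs_mk_symmetric subgraph_def intro: sym)
  have "pverts C \<noteq> {}" using assms(3) by auto
  then obtain u where u: "u \<in> pverts C" by blast
  have "\<exists>a b c. (a, c) \<in> parcs G \<and> (b, c) \<in> parcs G \<and> a \<noteq> b"
  proof (rule ccontr)
    assume "\<not> ?thesis"
    then have uniq: "a = b" if "(a, c) \<in> parcs G" "(b, c) \<in> parcs G" for a b c
      using that by blast
    \<comment> \<open>\<open>v\<close> is the only neighbour of \<open>u\<close>, or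
      \<open>u\<close> itself if \<open>u\<close> is isolated.\<close>
    obtain v where v: "v = u \<or> (u, v) \<in> parcs G" "\<And>y. (u, y) \<in> parcs G \<Longrightarrow> y = v"
      using uniq sym by metis
    have "w \<in> {u, v}" if w: "w \<in> pverts C" for w
    proof -
      have "(u, w) \<in> rtrancl_on (pverts C) (parcs (mk_symmetric C))"
        using conn u w
        by (simp add: Digraph_Component.connected_def strongly_connected_def reachable_def)
      then show ?thesis
      proof (induction rule: rtrancl_on_induct)
        case (step x y)
        then have "(x, y) \<in> parcs G" "(y, x) \<in> parcs G" using arcs by auto
        with step.IH v uniq show ?case by (metis insertCI insertE singletonD)
      qed simp
    qed
    then have "card (pverts C) \<le> card {u, v}"
      by (intro card_mono) auto
    also have "\<dots> \<le> 2" by (simp add: card_insert_if)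
    finally show False using assms(3) by simp
  qed
  with that show ?thesis by blast
qed

theorem theorem13:
  fixes G :: "'a pair_pre_digraph" and H :: "'b pair_pre_digraph" and n :: nat
  assumes "pair_graph G" and "pair_graph H" and "n = card (pverts G)"
  shows "((\<exists>C. connected_component G C \<and> card (pverts C) > 2) \<longrightarrow>
           int (roman_domination_number (G \<box> H)) \<le>
             (int n + 1) * int (roman_domination_number H) - 2 * int (domination_number H)) \<and>
         (roman_graph G \<longrightarrow>
           int (roman_domination_number (G \<box> H)) \<le>
             2 * int n * (int (roman_domination_number H) - int (domination_number H)) +
             2 * int (domination_number G) *
               (2 * int (domination_number H) - int (roman_domination_number H)))"
proof -
  interpret G: pair_graph G by fact
  interpret H: pair_graph H by fact
  have fin: "finite (pverts G)" "finite (pverts H)" by simp_all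
  show ?thesis
  proof (intro conjI impI)
    assume "\<exists>C. connected_component G C \<and> card (pverts C) > 2"
    then obtain a b c where *: "(a, c) \<in> parcs G" "(b, c) \<in> parcs G" "a \<noteq> b"
      using connected_component_two_neighbours[OF assms(1)] by metis
    then have "a \<noteq> c" "b \<noteq> c" by (auto dest: G.pair_no_loops)
    moreover have "a \<in> pverts G" "b \<in> pverts G" "c \<in> pverts G"
      using * by (auto dest: G.arc_fst_in_verts G.arc_snd_in_verts)
    ultimately have "int (roman_domination_number (G \<box> H)) \<le>
        int (card (pverts G)) * int (roman_domination_number H) -
        (int (card {a, b}) - int (card {c})) *
          (2 * int (domination_number H) - int (roman_domination_number H))"
      using * by (intro roman_domination_number_product_le fin) auto
    then show "int (roman_domination_number (G \<box> H)) \<le>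
        (int n + 1) * int (roman_domination_number H) - 2 * int (domination_number H)"
      \<comment> \<open>As \<open>a \<noteq> b\<close>, the factor
        \<open>card {a, b} - card {c}\<close> is 1.\<close>
      using *(3) by (simp add: assms(3) algebra_simps)
  next
    assume "roman_graph G"
    then have le: "2 * domination_number G \<le> n"
      using roman_domination_number_le_card[of G] by (simp add: roman_graph_def assms(3))
    obtain D where D: "dominating_set G D" and card: "card D = domination_number G"
      by (rule domination_number_attained)
    have sub: "D \<subseteq> pverts G" using D by (simp add: dominating_set_def)
    have "card (pverts G - D) = n - domination_number G"
      using sub fin(1) by (simp add: card_Diff_subset finite_subset card assms(3))
    \<comment> \<open>From \<open>2 * domination_number G \<le> n\<close>, the set \<open>D\<close>
      is at most as large as its complement.\<close>
    with le have card': "int (card (pverts G - D)) = int n - int (domination_number G)"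
      and "card D \<le> card (pverts G - D)"
      using card by linarith+
    then have "int (roman_domination_number (G \<box> H)) \<le>
        int n * int (roman_domination_number H) -
        (int (card (pverts G - D)) - int (card D)) *
          (2 * int (domination_number H) - int (roman_domination_number H))"
      using sub D unfolding assms(3)
      by (intro roman_domination_number_product_le fin) (auto simp: dominating_set_def)
    then show "int (roman_domination_number (G \<box> H)) \<le>
        2 * int n * (int (roman_domination_number H) - int (domination_number H)) +
        2 * int (domination_number G) *
          (2 * int (domination_number H) - int (roman_domination_number H))"
      \<comment> \<open>The factor is now \<open>n - 2 * domination_number G\<close>; expanding it
        and collecting the terms with \<open>n\<close> gives the stated form.\<close>
      by (simp add: card card' algebra_simps)
  qed
qed

end
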